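(* Let $(\bar x,\bar y,\bar s)$ be feasible for the SOCO pair $(P)$ $\min\{c^T\bar x: A\bar x=b,\ \bar x\in\mathcal L^n\}$ and $(D)$ $\max\{b^T\bar y: A^T\bar y+\bar s=c,\ \bar s\in\mathcal L^n\}$, i.e. $\bar x$ is feasible for $(P)$ and $(\bar y,\bar s)$ for $(D)$. Let $(X,y,S)$ be a mapped solution, that is, $S=\mathrm{Arw}(\bar s)$, $y=\bar y$, and $X\succeq0$ is a symmetric $n\times n$ matrix with $\sum_{i=1}^nX_{ii}=\bar x_1$ and $X_{1j}=\bar x_j/2$ for $j=2,\dots,n$. Then $(\bar x,\bar y,\bar s)$ is optimal for the SOCO pair with optimal value $(z_P^*,z_D^* )$ (i.e. $\bar x$ is optimal for $(P)$ with value $z_P^*$ and $(\bar y,\bar s)$ is optimal for $(D)$ with value $z_D^*$) if and only if $(X,y,S)$ is optimal, with the same optimal value $(z_P^*,z_D^* )$, for the SDO pair $$\min\{\mathrm{Tr}(\vec CX):\mathrm{Tr}(\vec A_iX)=b_i,\ i=1,\dots,m,\ X\succeq0\},\qquad \max\Big\{b^Ty:\sum_{i=1}^m y_i\vec A_i+S=\vec C,\ S\succeq 0\Big\},$$ where $\vec A_i=\mathrm{Arw}(a_{(i)})$ and $\vec C=\mathrm{Arw}(c)$.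
   Context: $A\in\mathbb R^{m\times n}$ has $i$-th row $a_{(i)}$; $b\in\mathbb R^m$, $c\in\mathbb R^n$. $\mathcal L^n=\{x\in\mathbb R^n: x_1\ge\|x_{2:n}\|_2\}$ with $x_{2:n}=(x_2,\dots,x_n)$. $\mathrm{Arw}(x)=\begin{pmatrix}x_1 & x_{2:n}^T\\ x_{2:n}& x_1I_{n-1}\end{pmatrix}$ for $x\in\mathbb R^n$. No strong-duality assumption is made. *)

theory Defs
  imports "HOL-Analysis.Analysis"
begin

text \<open>
  The coordinates of an \<open>'n rvec\<close> (that is, \<open>real^'n\<close>) are ordered by a linear order on \<open>'n\<close>:
  \<open>x\<^sub>1\<close> is \<open>x $ idx1\<close> and the tail \<open>x\<^sub>2\<^sub>:\<^sub>n\<close> consists of the remaining coordinates (none if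
  \<open>CARD('n) = 1\<close>). The synonyms avoid the \<open>real^'n\<close> syntax only because the latter attaches
  the sort \<open>finite\<close> to every occurrence of \<open>'n\<close>, which clashes with a sort stated once.
\<close>

type_synonym 'n rvec = "(real, 'n) vec"
type_synonym ('m, 'n) rmat = "((real, 'n) vec, 'm) vec"

definition idx1 :: "'n::{finite,linorder}"
  where "idx1 = Min UNIV"

definition lorentz_cone :: "('n::{finite,linorder}) rvec set"
  where "lorentz_cone = {x. x $ idx1 \<ge> L2_set (\<lambda>i. x $ i) (UNIV - {idx1})}"

definition Arw :: "('n::{finite,linorder}) rvec \<Rightarrow> ('n, 'n) rmat"
  where "Arw x = (\<chi> i j. if i = j then x $ idx1
                        else if i = idx1 then x $ j
                        else if j = idx1 then x $ i
                        else 0)"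

definition psd :: "('n::finite, 'n) rmat \<Rightarrow> bool"
  where "psd X \<longleftrightarrow> transpose X = X \<and> (\<forall>v. 0 \<le> v \<bullet> (X *v v))"

text \<open>
  The element \<open>x\<close> attains the minimum (maximum) of \<open>f\<close> over the feasible set \<open>F\<close>, and \<open>z\<close> is that
  optimal value.
\<close>

definition optimal_min :: "('a \<Rightarrow> real) \<Rightarrow> 'a set \<Rightarrow> 'a \<Rightarrow> real \<Rightarrow> bool"
  where "optimal_min f F x z \<longleftrightarrow> is_arg_min f (\<lambda>u. u \<in> F) x \<and> f x = z"

definition optimal_max :: "('a \<Rightarrow> real) \<Rightarrow> 'a set \<Rightarrow> 'a \<Rightarrow> real \<Rightarrow> bool"
  where "optimal_max f F x z \<longleftrightarrow> is_arg_max f (\<lambda>u. u \<in> F) x \<and> f x = z"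

definition soco_primal_feasible ::
    "('m::finite, 'n::{finite,linorder}) rmat \<Rightarrow> 'm rvec \<Rightarrow> 'n rvec set"
  where "soco_primal_feasible A b = {x. A *v x = b \<and> x \<in> lorentz_cone}"

definition soco_dual_feasible ::
    "('m::finite, 'n::{finite,linorder}) rmat \<Rightarrow> 'n rvec \<Rightarrow> ('m rvec \<times> 'n rvec) set"
  where "soco_dual_feasible A c = {(y, s). transpose A *v y + s = c \<and> s \<in> lorentz_cone}"

definition sdo_primal_feasible ::
    "('m::finite \<Rightarrow> ('n::finite, 'n) rmat) \<Rightarrow> 'm rvec \<Rightarrow> ('n, 'n) rmat set"
  where "sdo_primal_feasible M b = {X. (\<forall>i. trace (M i ** X) = b $ i) \<and> psd X}"

definition sdo_dual_feasible ::
    "('m::finite \<Rightarrow> ('n::finite, 'n) rmat) \<Rightarrow> ('n, 'n) rmat \<Rightarrow> ('m rvec \<times> ('n, 'n) rmat) set"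
  where "sdo_dual_feasible M C = {(y, S). (\<Sum>i\<in>UNIV. y $ i *\<^sub>R M i) + S = C \<and> psd S}"

definition mapped_solution ::
    "('n::{finite,linorder}) rvec \<Rightarrow> ('m::finite) rvec \<Rightarrow> 'n rvec
      \<Rightarrow> ('n, 'n) rmat \<Rightarrow> 'm rvec \<Rightarrow> ('n, 'n) rmat \<Rightarrow> bool"
  where "mapped_solution xbar ybar sbar X y S \<longleftrightarrow>
    S = Arw sbar \<and> y = ybar \<and> psd X \<and> (\<Sum>i\<in>UNIV. X $ i $ i) = xbar $ idx1 \<and>
    (\<forall>j. j \<noteq> idx1 \<longrightarrow> X $ idx1 $ j = xbar $ j / 2)"

end

theory Submission
  imports Defs
begin

text \<open>
  The adjoint of \<open>Arw\<close> with respect to the trace inner product maps the positive semidefinite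
  cone onto the Lorentz cone, and \<open>Arw\<close> itself maps precisely the Lorentz cone into the positive
  semidefinite cone. Hence the adjoint carries the primal SDO feasible set onto the primal SOCO
  feasible set, and \<open>Arw\<close> is a bijection between the dual feasible sets (the dual slack is forced
  to be an arrow matrix by the equality constraint). Both preserve the objectives, and no duality is
  involved.
\<close>

section \<open>The adjoint of \<open>Arw\<close> for the trace inner product\<close>

definition Arw_adj :: "('n::{finite,linorder}, 'n) rmat \<Rightarrow> 'n rvec"
  where "Arw_adj U = (\<chi> j. if j = idx1 then trace U else U $ idx1 $ j + U $ j $ idx1)"

definition outer :: "('n::finite) rvec \<Rightarrow> ('n, 'n) rmat"
  where "outer v = (\<chi> i j. v $ i * v $ j)"

lemma sum_split_idx1:
  fixes f :: "'n::{finite,linorder} \<Rightarrow> real"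
  shows "sum f UNIV = f idx1 + sum f (UNIV - {idx1})"
  by (rule sum.remove) auto

lemma inner_split_idx1:
  fixes x z :: "('n::{finite,linorder}) rvec"
  shows "x \<bullet> z = x $ idx1 * z $ idx1 + (\<Sum>j\<in>UNIV - {idx1}. x $ j * z $ j)"
  unfolding inner_vec_def by (subst sum_split_idx1) simp

text \<open>Multiplying by \<open>c $ idx1\<close> on the diagonal produces the trace of
  \<open>U\<close>, while each tail entry of \<open>c\<close> meets both \<open>U $ idx1 $ j\<close>
  and \<open>U $ j $ idx1\<close>. The symmetrised sum in \<open>Arw_adj\<close> makes this valid
  for every square \<open>U\<close>.\<close>

lemma trace_Arw_mult: "trace (Arw c ** U) = c \<bullet> Arw_adj U"
proof -
  have row1: "(Arw c ** U) $ idx1 $ idx1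
      = c $ idx1 * U $ idx1 $ idx1 + (\<Sum>k\<in>UNIV - {idx1}. c $ k * U $ k $ idx1)"
    by (simp add: matrix_matrix_mult_def Arw_def) (subst sum_split_idx1, auto intro!: sum.cong)
  have rowi: "(Arw c ** U) $ i $ i = c $ idx1 * U $ i $ i + c $ i * U $ idx1 $ i"
    if "i \<noteq> idx1" for i
  proof -
    \<comment> \<open>Row \<open>i\<close> of \<open>Arw c\<close> can be nonzero only in columns
      \<open>idx1\<close> and \<open>i\<close>.\<close>
    have "(Arw c ** U) $ i $ i
        = c $ i * U $ idx1 $ i + (\<Sum>k\<in>UNIV - {idx1}. (if i = k then c $ idx1 * U $ i $ i else 0))"
      unfolding matrix_matrix_mult_def vec_lambda_beta
      by (subst sum_split_idx1, intro arg_cong2[where f = "(+)"] sum.cong)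
        (use that in \<open>auto simp: Arw_def\<close>)
    also have "(\<Sum>k\<in>UNIV - {idx1}. (if i = k then c $ idx1 * U $ i $ i else 0)) = c $ idx1 * U $ i $ i"
      using that by simp
    finally show ?thesis by simp
  qed
  have tr: "trace U = U $ idx1 $ idx1 + (\<Sum>i\<in>UNIV - {idx1}. U $ i $ i)"
    unfolding trace_def by (rule sum_split_idx1)
  have "trace (Arw c ** U)
      = (Arw c ** U) $ idx1 $ idx1 + (\<Sum>i\<in>UNIV - {idx1}. (Arw c ** U) $ i $ i)"
    unfolding trace_def by (rule sum_split_idx1)
  also have "\<dots> = c $ idx1 * trace U
      + (\<Sum>j\<in>UNIV - {idx1}. c $ j * (U $ idx1 $ j + U $ j $ idx1))"
    by (simp add: row1 rowi tr sum.distrib sum_distrib_left algebra_simps)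
  also have "\<dots> = c \<bullet> Arw_adj U"
    by (simp add: inner_split_idx1 Arw_adj_def)
  finally show ?thesis .
qed

section \<open>Quadratic forms and positive semidefinite matrices\<close>

lemma inner_mult_eq_trace_outer:
  fixes M :: "('n::finite, 'n) rmat"
  shows "v \<bullet> (M *v v) = trace (M ** outer v)"
  by (simp add: inner_vec_def matrix_vector_mult_def trace_def matrix_matrix_mult_def outer_def
      sum_distrib_left sum_distrib_right mult_ac)

lemma inner_outer_mult:
  fixes v w :: "('n::finite) rvec"
  shows "w \<bullet> (outer v *v w) = (v \<bullet> w)\<^sup>2"
  by (simp add: inner_vec_def matrix_vector_mult_def outer_def power2_eq_square
      sum_product sum_distrib_left mult_ac)

lemma psd_add: "psd M \<Longrightarrow> psd N \<Longrightarrow> psd (M + N)"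
  by (simp add: psd_def transpose_def vec_eq_iff matrix_vector_mult_add_rdistrib inner_add_right)

lemma psd_scaleR: "psd M \<Longrightarrow> 0 \<le> r \<Longrightarrow> psd (r *\<^sub>R M)"
  by (simp add: psd_def transpose_def vec_eq_iff scaleR_matrix_vector_assoc[symmetric])

lemma psd_outer: "psd (outer v)"
  unfolding psd_def inner_outer_mult by (simp add: outer_def transpose_def vec_eq_iff mult.commute)

lemma psd_symD: "psd U \<Longrightarrow> U $ i $ j = U $ j $ i"
  by (simp add: psd_def transpose_def vec_eq_iff)

lemma inner_axis_mult_axis:
  fixes U :: "('n::finite, 'n) rmat"
  shows "axis i 1 \<bullet> (U *v axis j 1) = U $ i $ j"
  by (simp add: inner_axis' matrix_vector_mul_component inner_axis)

lemma psd_diag_nonneg: "psd U \<Longrightarrow> 0 \<le> U $ i $ i"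
  unfolding psd_def inner_axis_mult_axis[symmetric] by blast

text \<open>The quadratic form along \<open>t *\<^sub>R axis i 1 + axis j 1\<close> is a polynomial
  in \<open>t\<close> that is never negative, so its discriminant is at most zero.\<close>

lemma psd_minor:
  assumes "psd U"
  shows "(U $ i $ j)\<^sup>2 \<le> U $ i $ i * U $ j $ j"
proof -
  have "0 \<le> U $ i $ i * t\<^sup>2 + 2 * U $ i $ j * t + U $ j $ j" for t
  proof -
    let ?v = "t *\<^sub>R axis i 1 + axis j 1"
    have "0 \<le> ?v \<bullet> (U *v ?v)"
      using assms unfolding psd_def by blast
    also have "?v \<bullet> (U *v ?v) = U $ i $ i * t\<^sup>2 + 2 * U $ i $ j * t + U $ j $ j"
      using psd_symD[OF assms, of i j]
      by (simp add: matrix_vector_right_distrib matrix_vector_mult_scaleR inner_add_left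
          inner_add_right inner_axis_mult_axis power2_eq_square algebra_simps)
    finally show ?thesis .
  qed
  note q = this
  show ?thesis
  proof (cases "U $ i $ i = 0")
    case True
    have "U $ i $ j = 0"
    proof (rule ccontr)
      assume "U $ i $ j \<noteq> 0"
      \<comment> \<open>The polynomial is now affine in \<open>t\<close>; this \<open>t\<close>
        gives it the value -1.\<close>
      with q[of "- (U $ j $ j + 1) / (2 * U $ i $ j)"] True show False
        by (simp add: field_simps)
    qed
    then show ?thesis using True by simp
  next
    case False
    then have pos: "0 < U $ i $ i"
      using psd_diag_nonneg[OF assms, of i] by simp
    \<comment> \<open>This is the minimiser of the quadratic.\<close>
    with q[of "- (U $ i $ j) / U $ i $ i"] show ?thesis
      by (simp add: field_simps power2_eq_square)
  qed
qed

section \<open>The Lorentz cone and its correspondence with the semidefinite cone\<close>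

lemma mem_lorentz_cone_iff:
  "x \<in> lorentz_cone \<longleftrightarrow> 0 \<le> x $ idx1 \<and> (\<Sum>j\<in>UNIV - {idx1}. (x $ j)\<^sup>2) \<le> (x $ idx1)\<^sup>2"
proof -
  let ?S = "\<Sum>j\<in>UNIV - {idx1}. (x $ j)\<^sup>2"
  have "0 \<le> sqrt ?S"
    by (simp add: sum_nonneg)
  then have "sqrt ?S \<le> x $ idx1 \<longleftrightarrow> 0 \<le> x $ idx1 \<and> ?S \<le> (x $ idx1)\<^sup>2"
    using order_trans[of 0 "sqrt ?S" "x $ idx1"] real_le_lsqrt[of "x $ idx1" ?S] sqrt_le_D[of ?S]
    by blast
  then show ?thesis
    by (simp add: lorentz_cone_def L2_set_def)
qed

text \<open>By Cauchy-Schwarz the tails contribute at least minus the product of their norms, and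
  the leading product dominates it. This is one half of the self-duality of the cone.\<close>

lemma lorentz_cone_inner_nonneg:
  assumes "x \<in> lorentz_cone" "z \<in> lorentz_cone"
  shows "0 \<le> x \<bullet> z"
proof -
  let ?T = "UNIV - {idx1}"
  have "\<bar>\<Sum>j\<in>?T. x $ j * z $ j\<bar> \<le> (\<Sum>j\<in>?T. \<bar>x $ j\<bar> * \<bar>z $ j\<bar>)"
    by (rule order_trans[OF sum_abs]) (simp add: abs_mult)
  also have "\<dots> \<le> L2_set (\<lambda>j. x $ j) ?T * L2_set (\<lambda>j. z $ j) ?T"
    by (rule L2_set_mult_ineq)
  also have "\<dots> \<le> x $ idx1 * z $ idx1"
    using assms mem_lorentz_cone_iff[of x]
    by (intro mult_mono L2_set_nonneg) (auto simp: lorentz_cone_def)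
  finally show ?thesis by (simp add: inner_split_idx1)
qed

text \<open>Summing the 2 by 2 minor inequalities for row \<open>idx1\<close> bounds the squared
  tail norm by \<open>4 * ?u * ?s\<close>, which is at most the squared trace by AM-GM.\<close>

lemma Arw_adj_mem_lorentz_cone:
  assumes "psd U"
  shows "Arw_adj U \<in> lorentz_cone"
proof -
  let ?T = "UNIV - {idx1}"
  let ?u = "U $ idx1 $ idx1" and ?s = "\<Sum>j\<in>?T. U $ j $ j"
  have tr: "trace U = ?u + ?s"
    unfolding trace_def by (rule sum_split_idx1)
  have "0 \<le> ?u + ?s"
    using psd_diag_nonneg[OF assms] by (simp add: add_nonneg_nonneg sum_nonneg)
  moreover have "(\<Sum>j\<in>?T. (U $ idx1 $ j + U $ j $ idx1)\<^sup>2) \<le> (\<Sum>j\<in>?T. 4 * ?u * U $ j $ j)"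
  proof (rule sum_mono)
    fix j
    show "(U $ idx1 $ j + U $ j $ idx1)\<^sup>2 \<le> 4 * ?u * U $ j $ j"
      using psd_minor[OF assms, of idx1 j] psd_symD[OF assms, of j idx1]
      by (simp add: power2_eq_square)
  qed
  moreover have "(\<Sum>j\<in>?T. 4 * ?u * U $ j $ j) = 4 * ?u * ?s"
    by (simp add: sum_distrib_left)
  moreover have "4 * ?u * ?s \<le> (?u + ?s)\<^sup>2"
    using zero_le_power2[of "?u - ?s"] by (simp add: power2_eq_square algebra_simps)
  ultimately have "0 \<le> trace U"
    and "(\<Sum>j\<in>?T. (U $ idx1 $ j + U $ j $ idx1)\<^sup>2) \<le> (trace U)\<^sup>2"
    unfolding tr by linarith+
  then show ?thesis
    by (simp add: mem_lorentz_cone_iff Arw_adj_def)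
qed

text \<open>If the leading entry is zero, then \<open>x = 0\<close>. Otherwise a scaled
  \<open>outer x\<close> already yields the right tail, and only its trace has to be
  corrected.\<close>

lemma psd_preimage_Arw_adj:
  assumes "x \<in> lorentz_cone"
  obtains U where "psd U" "Arw_adj U = x"
proof -
  let ?a = "x $ idx1" and ?r = "\<Sum>j\<in>UNIV - {idx1}. (x $ j)\<^sup>2"
  have a: "0 \<le> ?a" and r: "?r \<le> ?a\<^sup>2"
    using assms by (auto simp: mem_lorentz_cone_iff)
  show thesis
  proof (cases "?a = 0")
    case True
    have "?r = 0"
      using r True by (simp add: order_antisym sum_nonneg)
    then have "x $ j = 0" if "j \<noteq> idx1" for j
      using that by (simp add: sum_nonneg_eq_0_iff)
    with True have "x = 0" by (metis vec_eq_iff zero_index)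
    then have "Arw_adj 0 = x"
      by (simp add: Arw_adj_def vec_eq_iff trace_def)
    moreover have "psd 0"
      by (simp add: psd_def transpose_def vec_eq_iff)
    ultimately show thesis by (rule that[rotated])
  next
    case False
    with a have a: "0 < ?a" by simp
    \<comment> \<open>The factor \<open>1 / (2 * ?a)\<close> makes the tail exact. The trace then
      falls short of \<open>?a\<close> by \<open>d\<close>, which is put into the leading diagonal
      entry, where it leaves the tail unchanged; \<open>0 \<le> d\<close> amounts to
      \<open>?r \<le> ?a\<^sup>2\<close>.\<close>
    define d where "d = (?a - ?r / ?a) / 2"
    define U where "U = (1 / (2 * ?a)) *\<^sub>R outer x + d *\<^sub>R outer (axis idx1 1)"
    have "0 \<le> d"
      using r a by (simp add: d_def field_simps power2_eq_square)
    then have "psd U"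
      unfolding U_def using a by (intro psd_add psd_scaleR psd_outer) auto
    moreover have "Arw_adj U = x"
    proof -
      have "trace U = (1 / (2 * ?a)) * (?a\<^sup>2 + ?r) + d"
        using a unfolding trace_def U_def outer_def
        by (subst sum_split_idx1)
          (simp add: axis_def power2_eq_square sum_divide_distrib add_divide_distrib)
      also have "\<dots> = ?a"
        using a by (simp add: d_def field_simps power2_eq_square)
      finally show ?thesis
        using a by (simp add: Arw_adj_def U_def outer_def axis_def vec_eq_iff)
    qed
    ultimately show thesis by (rule that)
  qed
qed

text \<open>The quadratic form of \<open>Arw x\<close> at \<open>v\<close> is the inner product of
  \<open>x\<close> with \<open>Arw_adj (outer v)\<close>, a point of the Lorentz cone, so membership
  of \<open>x\<close> suffices. Conversely, a single test vector extracts the cone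
  inequality.\<close>

lemma psd_Arw_iff: "psd (Arw x) \<longleftrightarrow> x \<in> lorentz_cone"
proof
  assume "x \<in> lorentz_cone"
  then have "0 \<le> v \<bullet> (Arw x *v v)" for v
    unfolding inner_mult_eq_trace_outer trace_Arw_mult
    by (intro lorentz_cone_inner_nonneg Arw_adj_mem_lorentz_cone psd_outer)
  moreover have "transpose (Arw x) = Arw x"
    by (auto simp: transpose_def Arw_def vec_eq_iff)
  ultimately show "psd (Arw x)"
    by (simp add: psd_def)
next
  let ?T = "UNIV - {idx1}"
  assume psd: "psd (Arw x)"
  define r where "r = L2_set (\<lambda>j. x $ j) ?T"
  have r: "0 \<le> r" and r2: "(\<Sum>j\<in>?T. (x $ j)\<^sup>2) = r\<^sup>2"
    by (simp_all add: r_def L2_set_def sum_nonneg)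
  have a: "0 \<le> x $ idx1"
    using psd_diag_nonneg[OF psd, of idx1] by (simp add: Arw_def)
  \<comment> \<open>An eigenvector of \<open>Arw x\<close> for its smallest eigenvalue \<open>x $ idx1 - r\<close> (if \<open>r > 0\<close>).\<close>
  define v :: "'a rvec" where "v = (\<chi> j. if j = idx1 then - r else x $ j)"
  have "0 \<le> v \<bullet> (Arw x *v v)"
    using psd unfolding psd_def by blast
  also have "\<dots> = x \<bullet> Arw_adj (outer v)"
    by (simp add: inner_mult_eq_trace_outer trace_Arw_mult)
  also have "\<dots> = x $ idx1 * (2 * r\<^sup>2) - 2 * r * r\<^sup>2"
  proof -
    have "trace (outer v) = 2 * r\<^sup>2"
      unfolding trace_def outer_def
      by (subst sum_split_idx1) (simp add: v_def r2[symmetric] power2_eq_square[symmetric])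
    moreover have "(\<Sum>j\<in>?T. x $ j * (v $ idx1 * v $ j + v $ j * v $ idx1)) = - 2 * r * r\<^sup>2"
      unfolding r2[symmetric] sum_distrib_left
      by (rule sum.cong) (auto simp: v_def power2_eq_square)
    ultimately show ?thesis
      by (simp add: inner_split_idx1 Arw_adj_def outer_def)
  qed
  finally have "0 \<le> r\<^sup>2 * (x $ idx1 - r)"
    by (simp add: algebra_simps)
  \<comment> \<open>For \<open>r = 0\<close> the test vector gives nothing; the claim is then the
    nonnegativity of the diagonal entry.\<close>
  then have "r \<le> x $ idx1"
    using a r by (cases "r = 0") (auto simp: zero_le_mult_iff)
  then show "x \<in> lorentz_cone"
    by (simp add: lorentz_cone_def r_def)
qed

section \<open>Feasible sets under the two maps\<close>

lemma Arw_add: "Arw (s + t) = Arw s + Arw t"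
  by (simp add: Arw_def vec_eq_iff)

lemma Arw_diff: "Arw (s - t) = Arw s - Arw t"
  by (simp add: Arw_def vec_eq_iff)

lemma Arw_sum_rows:
  "(\<Sum>i\<in>UNIV. y $ i *\<^sub>R Arw (row i A)) = Arw (transpose A *v y)"
  by (simp add: Arw_def vec_eq_iff row_def matrix_vector_mult_def transpose_def mult.commute)

lemma sdo_primal_feasible_Arw_iff:
  "U \<in> sdo_primal_feasible (\<lambda>i. Arw (row i A)) b \<longleftrightarrow> A *v Arw_adj U = b \<and> psd U"
  by (auto simp: sdo_primal_feasible_def trace_Arw_mult vec_eq_iff matrix_vector_mul_component
      row_def)

lemma Arw_adj_image_sdo_primal_feasible:
  "Arw_adj ` sdo_primal_feasible (\<lambda>i. Arw (row i A)) b = soco_primal_feasible A b"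
proof -
  have "x \<in> Arw_adj ` sdo_primal_feasible (\<lambda>i. Arw (row i A)) b"
    if "x \<in> soco_primal_feasible A b" for x
  proof -
    from that obtain U where "psd U" "Arw_adj U = x"
      using psd_preimage_Arw_adj by (auto simp: soco_primal_feasible_def)
    with that have "U \<in> sdo_primal_feasible (\<lambda>i. Arw (row i A)) b"
      by (simp add: sdo_primal_feasible_Arw_iff soco_primal_feasible_def)
    then show ?thesis using \<open>Arw_adj U = x\<close> by blast
  qed
  then show ?thesis
    by (auto simp: sdo_primal_feasible_Arw_iff soco_primal_feasible_def Arw_adj_mem_lorentz_cone)
qed

lemma sdo_dual_feasible_Arw_eq:
  "sdo_dual_feasible (\<lambda>i. Arw (row i A)) (Arw c)
    = (\<lambda>(y, s). (y, Arw s)) ` soco_dual_feasible A c"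
proof -
  have "(y, S) \<in> sdo_dual_feasible (\<lambda>i. Arw (row i A)) (Arw c)
      \<longleftrightarrow> (\<exists>s. S = Arw s \<and> (y, s) \<in> soco_dual_feasible A c)" for y S
  proof
    assume "(y, S) \<in> sdo_dual_feasible (\<lambda>i. Arw (row i A)) (Arw c)"
    \<comment> \<open>Linearity of \<open>Arw\<close> lets the equality constraint be solved for the
      slack.\<close>
    then have "S = Arw (c - transpose A *v y)" "psd S"
      by (auto simp: sdo_dual_feasible_def Arw_sum_rows Arw_diff algebra_simps)
    then show "\<exists>s. S = Arw s \<and> (y, s) \<in> soco_dual_feasible A c"
      by (auto simp: soco_dual_feasible_def psd_Arw_iff)
  next
    assume "\<exists>s. S = Arw s \<and> (y, s) \<in> soco_dual_feasible A c"
    then show "(y, S) \<in> sdo_dual_feasible (\<lambda>i. Arw (row i A)) (Arw c)"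
      by (auto simp: soco_dual_feasible_def sdo_dual_feasible_def Arw_sum_rows psd_Arw_iff
          Arw_add[symmetric])
  qed
  then show ?thesis by force
qed

lemma optimal_min_image_iff:
  assumes "u \<in> F" "\<And>w. w \<in> F \<Longrightarrow> f (h w) = g w"
  shows "optimal_min f (h ` F) (h u) z \<longleftrightarrow> optimal_min g F u z"
  using assms by (auto simp: optimal_min_def is_arg_min_def)

lemma optimal_max_image_iff:
  assumes "u \<in> F" "\<And>w. w \<in> F \<Longrightarrow> f (h w) = g w"
  shows "optimal_max f (h ` F) (h u) z \<longleftrightarrow> optimal_max g F u z"
  using assms by (auto simp: optimal_max_def is_arg_max_def)

theorem corollary3p3:
  fixes A :: "('m::finite, 'n::{finite,linorder}) rmat" and b :: "'m rvec" and c :: "'n rvec"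
    and xbar sbar :: "'n rvec" and ybar :: "'m rvec"
    and X S :: "('n, 'n) rmat" and y :: "'m rvec"
    and zP zD :: real
  assumes "xbar \<in> soco_primal_feasible A b"
    and "(ybar, sbar) \<in> soco_dual_feasible A c"
    and "mapped_solution xbar ybar sbar X y S"
  shows "(optimal_min (\<lambda>u. c \<bullet> u) (soco_primal_feasible A b) xbar zP \<and>
          optimal_max (\<lambda>(v, t). b \<bullet> v) (soco_dual_feasible A c) (ybar, sbar) zD)
     \<longleftrightarrow>
         (optimal_min (\<lambda>U. trace (Arw c ** U))
            (sdo_primal_feasible (\<lambda>i. Arw (row i A)) b) X zP \<and>
          optimal_max (\<lambda>(v, T). b \<bullet> v)
            (sdo_dual_feasible (\<lambda>i. Arw (row i A)) (Arw c)) (y, S) zD)"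
proof -
  let ?M = "\<lambda>i. Arw (row i A)"
  have psd: "psd X" and tr: "trace X = xbar $ idx1"
    and col: "\<And>j. j \<noteq> idx1 \<Longrightarrow> X $ idx1 $ j = xbar $ j / 2"
    and y: "y = ybar" and S: "S = Arw sbar"
    using assms(3) by (auto simp: mapped_solution_def trace_def)
  \<comment> \<open>By symmetry of \<open>X\<close>, the two halves \<open>xbar $ j / 2\<close> in
    row and column \<open>idx1\<close> add up to \<open>xbar $ j\<close>.\<close>
  have adj: "Arw_adj X = xbar"
    using psd_symD[OF psd, of _ idx1] by (simp add: Arw_adj_def vec_eq_iff tr col)
  have X: "X \<in> sdo_primal_feasible ?M b"
    using assms(1) psd by (simp add: sdo_primal_feasible_Arw_iff soco_primal_feasible_def adj)
  \<comment> \<open>The primal and dual equivalences hold separately, each with its own optimal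
    value.\<close>
  have "optimal_min (\<lambda>u. c \<bullet> u) (Arw_adj ` sdo_primal_feasible ?M b) (Arw_adj X) zP
      \<longleftrightarrow> optimal_min (\<lambda>U. trace (Arw c ** U)) (sdo_primal_feasible ?M b) X zP"
    by (rule optimal_min_image_iff[OF X]) (simp add: trace_Arw_mult)
  moreover have "optimal_max (\<lambda>(v, T). b \<bullet> v)
        ((\<lambda>(y, s). (y, Arw s)) ` soco_dual_feasible A c) ((\<lambda>(y, s). (y, Arw s)) (ybar, sbar)) zD
      \<longleftrightarrow> optimal_max (\<lambda>(v, t). b \<bullet> v) (soco_dual_feasible A c) (ybar, sbar) zD"
    by (rule optimal_max_image_iff[OF assms(2)]) auto
  ultimately show ?thesis
    by (simp add: Arw_adj_image_sdo_primal_feasible sdo_dual_feasible_Arw_eq adj y S)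
qed

end
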